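(* Let $a,b$ be axes in $A$. Then the following are equivalent: (i) $[L_a,L_b]$ is a derivation on $A$. (ii) All of the following hold: (a) $b_{1/2}(x_0y_0)=(b_{1/2}x_0)y_0+(b_{1/2}y_0)x_0$ for all $x_0,y_0\in A_0(a)$; (b) $\big(b_{1/2}(x_{1/2}y_0)\big)_0=(b_{1/2}x_{1/2})y_0-\big((b_{1/2}y_0)x_{1/2}\big)_0$ for all $x_{1/2}\in A_{1/2}(a)$ and $y_0\in A_0(a)$; (c) $b_{1/2}(x_{1/2}y_{1/2})+(b_{1/2}x_{1/2})y_{1/2}+(b_{1/2}y_{1/2})x_{1/2}=\frac12(b,y_{1/2})x_{1/2}+\frac12(b,x_{1/2})y_{1/2}+(a,x_{1/2}y_{1/2})b_{1/2}$ for all $x_{1/2},y_{1/2}\in A_{1/2}(a)$.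
   Context: $\mathbb{F}$ is a field of characteristic not $2$ and $A$ is a commutative, not necessarily associative, $\mathbb{F}$-algebra equipped with a Frobenius form, i.e. a symmetric bilinear form $(\cdot,\cdot):A\times A\to\mathbb{F}$ with $(xy,z)=(x,yz)$ for all $x,y,z\in A$. For $z\in A$ and $\lambda\in\mathbb{F}$ put $A_\lambda(z)=\{x\in A: zx=\lambda x\}$. An axis is an idempotent $c\in A$ (so $c^2=c$) such that $(c,c)=1$, $A=\mathbb{F}c\oplus A_0(c)\oplus A_{1/2}(c)$, and the fusion rules hold: for $x_0,y_0\in A_0(c)$ and $x_{1/2},y_{1/2}\in A_{1/2}(c)$ one has $x_0y_0\in A_0(c)$, $x_0y_{1/2}\in A_{1/2}(c)$, $x_{1/2}y_{1/2}\in\mathbb{F}c+A_0(c)$. Given the axis $a$, each $x\in A$ is written uniquely $x=(a,x)a+x_0+x_{1/2}$ with $x_\lambda\in A_\lambda(a)$, $\lambda\in\{0,\frac12\}$; $(x)_0$ and $(x)_{1/2}$ also denote these components. In particular $b=(a,b)a+b_0+b_{1/2}$. For $x\in A$, $L_x(y)=xy$, and $[L_x,L_y]=L_xL_y-L_yL_x$. A derivation on $A$ is an $\mathbb{F}$-linear map $D:A\to A$ with $D(xy)=xD(y)+D(x)y$ for all $x,y\in A$. *)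

theory Defs
  imports Complex_Main
begin

(* A commutative, not necessarily associative, algebra over a field of characteristic not 2,
   with a Frobenius form.  Linearity in the other argument of the product and of the form
   follows from commutativity and symmetry. *)
locale frobenius_algebra = vector_space scale
  for scale :: "'f::field \<Rightarrow> 'a::ab_group_add \<Rightarrow> 'a"  (infixr "*s" 75) +
  fixes mult :: "'a \<Rightarrow> 'a \<Rightarrow> 'a"  (infixl "\<bullet>" 70)
    and form :: "'a \<Rightarrow> 'a \<Rightarrow> 'f"
  assumes char_not_2: "CHAR('f) \<noteq> 2"
    and mult_linear: "Vector_Spaces.linear scale scale (mult x)"
    and mult_commute: "x \<bullet> y = y \<bullet> x"
    and form_linear: "Vector_Spaces.linear scale (*) (form x)"
    and form_sym: "form x y = form y x"
    and form_assoc: "form (x \<bullet> y) z = form x (y \<bullet> z)"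
begin

definition eigenspace :: "'a \<Rightarrow> 'f \<Rightarrow> 'a set" where
  "eigenspace z l = {x. z \<bullet> x = l *s x}"

definition is_axis :: "'a \<Rightarrow> bool" where
  "is_axis c \<longleftrightarrow>
     c \<bullet> c = c \<and> form c c = 1 \<and>
     (\<forall>x. \<exists>!p. case p of (u, v, w) \<Rightarrow>
        u \<in> span {c} \<and> v \<in> eigenspace c 0 \<and> w \<in> eigenspace c (1/2) \<and> x = u + v + w) \<and>
     (\<forall>x\<in>eigenspace c 0. \<forall>y\<in>eigenspace c 0. x \<bullet> y \<in> eigenspace c 0) \<and>
     (\<forall>x\<in>eigenspace c 0. \<forall>y\<in>eigenspace c (1/2). x \<bullet> y \<in> eigenspace c (1/2)) \<and>
     (\<forall>x\<in>eigenspace c (1/2). \<forall>y\<in>eigenspace c (1/2).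
        \<exists>u\<in>span {c}. \<exists>v\<in>eigenspace c 0. x \<bullet> y = u + v)"

(* The components x_0 and x_{1/2} of x with respect to a; meaningful when a is an axis, in which
   case the component of x in the span of a is form a x *s a. *)
definition comp_zero :: "'a \<Rightarrow> 'a \<Rightarrow> 'a" where
  "comp_zero a x = (THE v. v \<in> eigenspace a 0 \<and>
     (\<exists>w\<in>eigenspace a (1/2). x = form a x *s a + v + w))"

definition comp_half :: "'a \<Rightarrow> 'a \<Rightarrow> 'a" where
  "comp_half a x = (THE w. w \<in> eigenspace a (1/2) \<and>
     (\<exists>v\<in>eigenspace a 0. x = form a x *s a + v + w))"

definition derivation :: "('a \<Rightarrow> 'a) \<Rightarrow> bool" where
  "derivation D \<longleftrightarrow> Vector_Spaces.linear scale scale D \<and>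
     (\<forall>x y. D (x \<bullet> y) = x \<bullet> D y + D x \<bullet> y)"

end

definition commutator :: "('a \<Rightarrow> 'a) \<Rightarrow> ('a \<Rightarrow> 'a) \<Rightarrow> 'a \<Rightarrow> 'a::ab_group_add" where
  "commutator f g = (\<lambda>x. f (g x) - g (f x))"

end

theory Submission
  imports Defs
begin

text \<open>
  Write \<open>h\<close> for the component of \<open>b\<close> in the \<open>1/2\<close>-eigenspace of \<open>a\<close>.  By the fusion rules \<open>L\<^sub>a\<close> commutes
  with multiplication by the \<open>0\<close>-component of \<open>b\<close>, so \<open>[L\<^sub>a, L\<^sub>b] = [L\<^sub>a, L\<^sub>h]\<close>, and this
  operator \<open>D\<close> satisfies \<open>D a = - h/4\<close>, \<open>D x = (h x)/2\<close> for \<open>x\<close> in the \<open>0\<close>-eigenspace, and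
  \<open>D x = ((b, x) a - h x)/2\<close> for \<open>x\<close> in the \<open>1/2\<close>-eigenspace.  The Leibniz rule is bilinear, so it
  only has to be tested on pairs of eigenvectors of \<open>a\<close>.  It holds automatically whenever one of
  the two is \<open>a\<close>, and the three remaining kinds of pairs give (a), (b) and (c).
\<close>

context frobenius_algebra
begin

section \<open>Bilinearity of the product and of the form, and division by two\<close>

lemma mult_add_right: "x \<bullet> (y + z) = x \<bullet> y + x \<bullet> z"
  and mult_diff_right: "x \<bullet> (y - z) = x \<bullet> y - x \<bullet> z"
  and mult_minus_right: "x \<bullet> (- y) = - (x \<bullet> y)"
  and mult_zero_right: "x \<bullet> 0 = 0"
  and mult_scale_right: "x \<bullet> (r *s y) = r *s (x \<bullet> y)"
proof -
  interpret Vector_Spaces.linear scale scale "mult x" by (rule mult_linear)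
  show "x \<bullet> (y + z) = x \<bullet> y + x \<bullet> z" "x \<bullet> (y - z) = x \<bullet> y - x \<bullet> z" "x \<bullet> (- y) = - (x \<bullet> y)"
    "x \<bullet> 0 = 0" "x \<bullet> (r *s y) = r *s (x \<bullet> y)"
    by (rule add diff neg zero scale)+
qed

lemma mult_add_left: "(y + z) \<bullet> x = y \<bullet> x + z \<bullet> x"
  and mult_diff_left: "(y - z) \<bullet> x = y \<bullet> x - z \<bullet> x"
  and mult_minus_left: "(- y) \<bullet> x = - (y \<bullet> x)"
  and mult_zero_left: "0 \<bullet> x = 0"
  and mult_scale_left: "(r *s y) \<bullet> x = r *s (y \<bullet> x)"
  by (simp_all only: mult_commute[of _ x] mult_add_right mult_diff_right mult_minus_right
      mult_zero_right mult_scale_right)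

lemmas mult_bilinear =
  mult_add_right mult_diff_right mult_minus_right mult_zero_right mult_scale_right
  mult_add_left mult_diff_left mult_minus_left mult_zero_left mult_scale_left

lemma form_add_right: "form x (y + z) = form x y + form x z"
  and form_scale_right: "form x (r *s y) = r * form x y"
proof -
  interpret Vector_Spaces.linear scale "(*)" "form x" by (rule form_linear)
  show "form x (y + z) = form x y + form x z" "form x (r *s y) = r * form x y"
    by (rule add scale)+
qed

lemma form_add_left: "form (y + z) x = form y x + form z x"
  and form_scale_left: "form (r *s y) x = r * form y x"
  by (simp_all add: form_sym[of _ x] form_add_right form_scale_right)

text \<open>If 2 vanished, the characteristic would divide 2, hence be 1 or 2; a field never has
  characteristic 1, and 2 is excluded.\<close>

lemma two_neq_zero: "(2::'f) \<noteq> 0"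
proof
  assume "(2::'f) = 0"
  then have "CHAR('f) dvd 2"
    by (metis of_nat_eq_0_iff_char_dvd of_nat_numeral)
  then have "CHAR('f) \<le> 2" "CHAR('f) \<noteq> 0"
    using dvd_imp_le[of "CHAR('f)" 2] by (auto intro: Nat.gr0I)
  with char_not_2 CHAR_not_1'[where 'a = 'f] show False
    by simp
qed

lemma half_plus_half: "(1/2::'f) + 1/2 = 1"
  using two_neq_zero by (simp add: field_simps)

lemma one_neq_half: "(1::'f) \<noteq> 1/2"
  using half_plus_half by (metis add_cancel_left_left zero_neq_one)

lemma scale_half_cancel: "(1/2) *s x = (1/2) *s y \<longleftrightarrow> x = y"
  using two_neq_zero by simp

lemma scale_half_add_half: "(1/2) *s x + (1/2) *s x = x"
  by (simp only: scale_left_distrib[symmetric] half_plus_half scale_one)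

section \<open>Eigenspaces, and derivations tested on spanning sets\<close>

lemma subspace_eigenspace: "subspace (eigenspace z l)"
  by (rule subspaceI)
    (simp_all add: eigenspace_def mult_bilinear scale_right_distrib scale_left_commute)

lemma eigenspace_zero_iff: "x \<in> eigenspace z 0 \<longleftrightarrow> z \<bullet> x = 0"
  by (simp add: eigenspace_def)

lemma eigenspace_half_iff: "x \<in> eigenspace z (1/2) \<longleftrightarrow> z \<bullet> x = (1/2) *s x"
  by (simp add: eigenspace_def)

text \<open>Associativity of the form makes multiplication by \<open>z\<close> self-adjoint, so
  eigenvectors for distinct eigenvalues are orthogonal.\<close>

lemma form_eigenspaces_orthogonal:
  assumes "x \<in> eigenspace z l" "y \<in> eigenspace z m" "l \<noteq> m"
  shows "form x y = 0"
proof -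
  have "l * form x y = form (z \<bullet> x) y"
    using assms(1) by (simp add: eigenspace_def form_scale_left)
  also have "\<dots> = form x (z \<bullet> y)"
    by (metis form_assoc mult_commute)
  also have "\<dots> = m * form x y"
    using assms(2) by (simp add: eigenspace_def form_scale_right)
  finally show ?thesis
    using assms(3) by simp
qed

lemma derivation_iff_spanning:
  assumes D: "Vector_Spaces.linear scale scale D" and S: "span S = UNIV"
  shows "derivation D \<longleftrightarrow> (\<forall>x\<in>S. \<forall>y\<in>S. D (x \<bullet> y) = x \<bullet> D y + D x \<bullet> y)"
proof (intro iffI ballI)
  assume L: "\<forall>x\<in>S. \<forall>y\<in>S. D (x \<bullet> y) = x \<bullet> D y + D x \<bullet> y"
  interpret D: Vector_Spaces.linear scale scale D by (rule D)
  \<comment> \<open>For fixed \<open>x\<close> the rule is linear in \<open>y\<close>, so validity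
    on \<open>S\<close> extends to the whole space. This is applied once in each argument, with
    commutativity exchanging the two in between.\<close>
  have sub: "subspace {y. D (x \<bullet> y) = x \<bullet> D y + D x \<bullet> y}" for x
    by (rule subspaceI)
      (simp_all add: mult_bilinear D.add D.scale D.zero scale_right_distrib algebra_simps)
  have ext: "D (x \<bullet> y) = x \<bullet> D y + D x \<bullet> y"
    if "\<forall>s\<in>S. D (x \<bullet> s) = x \<bullet> D s + D x \<bullet> s" for x y
    using span_minimal[OF _ sub, of S x] that S by blast
  have "D (x \<bullet> y) = x \<bullet> D y + D x \<bullet> y" if "x \<in> S" for x y
    using ext L that by blast
  then have "D (x \<bullet> y) = x \<bullet> D y + D x \<bullet> y" if "y \<in> S" for x y
    using that by (metis mult_commute add.commute)
  then have "D (x \<bullet> y) = x \<bullet> D y + D x \<bullet> y" for x y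
    using ext by blast
  with D show "derivation D"
    by (simp add: derivation_def)
qed (simp add: derivation_def)

lemma linear_commutator_mult: "Vector_Spaces.linear scale scale (commutator (mult a) (mult b))"
  by unfold_locales
    (simp_all add: commutator_def mult_bilinear scale_right_diff_distrib algebra_simps)

end

section \<open>Decomposition of the algebra with respect to an axis\<close>

locale frobenius_algebra_axis = frobenius_algebra scale mult form
  for scale :: "'f::field \<Rightarrow> 'a::ab_group_add \<Rightarrow> 'a"  (infixr "*s" 75)
    and mult :: "'a \<Rightarrow> 'a \<Rightarrow> 'a"  (infixl "\<bullet>" 70)
    and form :: "'a \<Rightarrow> 'a \<Rightarrow> 'f" +
  fixes a :: 'a
  assumes axis: "is_axis a"
begin

abbreviation "A0 \<equiv> eigenspace a 0"
abbreviation "Ah \<equiv> eigenspace a (1/2)"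

lemma axis_idem: "a \<bullet> a = a" and axis_form: "form a a = 1"
  using axis unfolding is_axis_def by blast+

lemma axis_mem: "a \<in> eigenspace a 1"
  by (simp add: eigenspace_def axis_idem)

lemma fusion_zero_zero: "x \<in> A0 \<Longrightarrow> y \<in> A0 \<Longrightarrow> x \<bullet> y \<in> A0"
  and fusion_zero_half: "x \<in> A0 \<Longrightarrow> y \<in> Ah \<Longrightarrow> x \<bullet> y \<in> Ah"
  using axis unfolding is_axis_def by blast+

lemma fusion_half_zero: "x \<in> Ah \<Longrightarrow> y \<in> A0 \<Longrightarrow> x \<bullet> y \<in> Ah"
  using fusion_zero_half by (simp only: mult_commute[of x])

lemma axis_form_zero: "x \<in> A0 \<Longrightarrow> form a x = 0"
  using form_eigenspaces_orthogonal[OF axis_mem] by simp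

lemma axis_form_half: "x \<in> Ah \<Longrightarrow> form a x = 0"
  by (rule form_eigenspaces_orthogonal[OF axis_mem _ one_neq_half])

text \<open>Pairing a decomposition with \<open>a\<close> identifies the coefficient of
  \<open>a\<close>, because \<open>form a a = 1\<close> and the two other eigenspaces are orthogonal
  to \<open>a\<close>.\<close>

lemma axis_decomposition:
  obtains v w where "v \<in> A0" "w \<in> Ah" "x = form a x *s a + v + w"
proof -
  have "\<exists>p. case p of (u, v, w) \<Rightarrow> u \<in> span {a} \<and> v \<in> A0 \<and> w \<in> Ah \<and> x = u + v + w"
    using axis unfolding is_axis_def by (blast intro: ex1_implies_ex)
  then obtain r v w where vw: "v \<in> A0" "w \<in> Ah" "x = r *s a + v + w"
    by (auto simp: span_singleton)
  then have "form a x = r"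
    by (simp add: form_add_right form_scale_right axis_form axis_form_zero axis_form_half)
  then have "x = form a x *s a + v + w"
    using vw(3) by (simp only:)
  with vw(1,2) show thesis
    by (rule that)
qed

lemma axis_decomposition_unique:
  assumes "v \<in> A0" "w \<in> Ah" "v' \<in> A0" "w' \<in> Ah" "r *s a + v + w = r' *s a + v' + w'"
  shows "v = v'" "w = w'"
proof -
  let ?P = "\<lambda>(u, v', w'). u \<in> span {a} \<and> v' \<in> A0 \<and> w' \<in> Ah \<and> r *s a + v + w = u + v' + w'"
  have "\<forall>x. \<exists>!p. case p of (u, v, w) \<Rightarrow>
      u \<in> span {a} \<and> v \<in> A0 \<and> w \<in> Ah \<and> x = u + v + w"
    using axis unfolding is_axis_def by (elim conjE)
  then have "\<exists>!p. ?P p" ..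
  \<comment> \<open>Both given decompositions are triples satisfying \<open>?P\<close>, so both
    equal \<open>p\<close>.\<close>
  then obtain p where p: "\<forall>q. ?P q \<longrightarrow> q = p"
    by (elim ex1E) (rule that)
  have "?P (r *s a, v, w)" "?P (r' *s a, v', w')"
    unfolding case_prod_conv by (intro conjI span_scale span_base singletonI assms refl)+
  with p have "(r *s a, v, w) = p" "(r' *s a, v', w') = p"
    by simp_all
  then have "(r *s a, v, w) = (r' *s a, v', w')"
    by (rule trans[OF _ sym])
  then show "v = v'" "w = w'" by simp_all
qed

text \<open>Evaluates the definite descriptions: uniqueness of the decomposition lets components be
  read off from any explicit one.\<close>

lemma comp_eqI:
  assumes "v \<in> A0" "w \<in> Ah" "x = form a x *s a + v + w"
  shows "comp_zero a x = v" "comp_half a x = w"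
proof -
  have unique: "v' = v \<and> w' = w" if "v' \<in> A0" "w' \<in> Ah" "x = form a x *s a + v' + w'" for v' w'
    using axis_decomposition_unique[OF that(1,2) assms(1,2) trans[OF that(3)[symmetric] assms(3)]]
    by blast
  show "comp_zero a x = v"
    unfolding comp_zero_def
    by (rule the_equality) (use assms unique in blast)+
  show "comp_half a x = w"
    unfolding comp_half_def
    by (rule the_equality) (use assms unique in blast)+
qed

lemma comp_zero_mem: "comp_zero a x \<in> A0"
  and comp_half_mem: "comp_half a x \<in> Ah"
  and comp_decomposition: "x = form a x *s a + comp_zero a x + comp_half a x"
proof -
  obtain v w where vw: "v \<in> A0" "w \<in> Ah" "x = form a x *s a + v + w"
    by (rule axis_decomposition)
  show "comp_zero a x \<in> A0" "comp_half a x \<in> Ah"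
    "x = form a x *s a + comp_zero a x + comp_half a x"
    unfolding comp_eqI[OF vw] by (rule vw)+
qed

lemma span_eigenspaces: "span (insert a (A0 \<union> Ah)) = UNIV"
proof -
  have "x \<in> span (insert a (A0 \<union> Ah))" for x
    by (subst comp_decomposition[of x], intro span_add span_scale span_base)
      (use comp_zero_mem comp_half_mem in auto)
  then show ?thesis by blast
qed

text \<open>The fusion rule leaves no part in \<open>Ah\<close>, and pairing with \<open>a\<close>
  gives the coefficient of \<open>a\<close>.\<close>

lemma half_mult_half:
  assumes "x \<in> Ah" "y \<in> Ah"
  shows "x \<bullet> y = form a (x \<bullet> y) *s a + comp_zero a (x \<bullet> y)"
proof -
  have "\<exists>u\<in>span {a}. \<exists>v\<in>A0. x \<bullet> y = u + v"
    using axis assms unfolding is_axis_def by blast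
  then obtain r v where v: "v \<in> A0" "x \<bullet> y = r *s a + v"
    by (auto simp: span_singleton)
  moreover have "0 \<in> Ah"
    using subspace_eigenspace subspace_0 by blast
  moreover have "form a (x \<bullet> y) = r"
    using v by (simp add: form_add_right form_scale_right axis_form axis_form_zero)
  ultimately have "comp_zero a (x \<bullet> y) = v"
    by (intro comp_eqI(1)[of _ 0]) simp_all
  with v \<open>form a (x \<bullet> y) = r\<close> show ?thesis by simp
qed

lemma axis_mult_half_half:
  assumes "x \<in> Ah" "y \<in> Ah"
  shows "a \<bullet> (x \<bullet> y) = form a (x \<bullet> y) *s a"
proof -
  have "a \<bullet> comp_zero a (x \<bullet> y) = 0"
    using comp_zero_mem by (simp only: eigenspace_zero_iff)
  with arg_cong[OF half_mult_half[OF assms], of "mult a"] show ?thesis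
    by (simp only: mult_bilinear axis_idem add_0_right)
qed

text \<open>Pairing with \<open>x\<close> annihilates the other two components of \<open>b\<close>
  by orthogonality.\<close>

lemma form_comp_half:
  assumes "x \<in> Ah"
  shows "form (comp_half a b) x = form b x"
proof -
  have "form b x = form a b * form a x + form (comp_zero a b) x + form (comp_half a b) x"
    using arg_cong[OF comp_decomposition[of b], of "\<lambda>u. form u x"]
    by (simp only: form_add_left form_scale_left)
  moreover have "form (comp_zero a b) x = 0"
    by (rule form_eigenspaces_orthogonal[OF comp_zero_mem assms]) (use two_neq_zero in simp)
  ultimately show ?thesis
    using axis_form_half[OF assms] by simp
qed

text \<open>Associativity of the form moves \<open>a\<close> onto \<open>x\<close>, where it acts as
  1/2.\<close>

lemma axis_form_half_mult:
  assumes "x \<in> Ah"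
  shows "form a (x \<bullet> y) = 1/2 * form x y"
  using assms by (simp add: form_assoc[symmetric] eigenspace_half_iff form_scale_left)

section \<open>The commutator on the eigenspaces of the axis\<close>

context
  fixes b :: 'a
begin

abbreviation "h \<equiv> comp_half a b"
abbreviation "D \<equiv> commutator (mult a) (mult b)"

lemma axis_form_comp_half_mult:
  assumes "x \<in> Ah"
  shows "form a (h \<bullet> x) = 1/2 * form b x"
  by (simp only: axis_form_half_mult[OF comp_half_mem] form_comp_half[OF assms])

lemma axis_mult_comp_half_mult:
  assumes "x \<in> Ah"
  shows "a \<bullet> (h \<bullet> x) = (1/2) *s (form b x *s a)"
  by (simp only: axis_mult_half_half[OF comp_half_mem assms] axis_form_comp_half_mult[OF assms]
      scale_scale)

text \<open>On an eigenvector whose product with \<open>comp_zero a b\<close> stays in the same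
  eigenspace, the contributions of \<open>form a b *s a\<close> and of \<open>comp_zero a b\<close>
  to the commutator cancel; only that of \<open>h\<close> survives.\<close>

lemma commutator_eigenspace:
  assumes "x \<in> eigenspace a l" "comp_zero a b \<bullet> x \<in> eigenspace a l"
  shows "D x = a \<bullet> (h \<bullet> x) - l *s (h \<bullet> x)"
proof -
  have b: "b \<bullet> y = form a b *s (a \<bullet> y) + comp_zero a b \<bullet> y + h \<bullet> y" for y
    using arg_cong[OF comp_decomposition[of b], of "\<lambda>u. u \<bullet> y"]
    by (simp only: mult_add_left mult_scale_left)
  show ?thesis
    using assms unfolding commutator_def eigenspace_def
    by (simp add: b mult_bilinear scale_right_distrib scale_left_commute)
qed

text \<open>Since \<open>h\<close> lies in \<open>Ah\<close>, the coefficient is 1/4 - 1/2 = -1/4,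
  kept as an iterated half so that all later cancellations reduce to halves.\<close>

lemma commutator_axis: "D a = - ((1/2) *s ((1/2) *s h))"
proof -
  have "comp_zero a b \<bullet> a = 0"
    using comp_zero_mem[of b] by (simp add: eigenspace_zero_iff mult_commute)
  then have "D a = a \<bullet> (h \<bullet> a) - h \<bullet> a"
    using commutator_eigenspace[OF axis_mem] subspace_0[OF subspace_eigenspace] by simp
  also have "h \<bullet> a = (1/2) *s h"
    using comp_half_mem[of b] by (simp add: eigenspace_half_iff mult_commute)
  also have "a \<bullet> ((1/2) *s h) = (1/2) *s ((1/2) *s h)"
    using comp_half_mem[of b] by (simp only: eigenspace_half_iff mult_scale_right)
  also have "(1/2) *s ((1/2) *s h) - (1/2) *s h = - ((1/2) *s ((1/2) *s h))"
    using scale_half_add_half[of "(1/2) *s h"] by (metis add_diff_cancel_left' minus_diff_eq)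
  finally show ?thesis .
qed

lemma commutator_zero:
  assumes "x \<in> A0"
  shows "D x = (1/2) *s (h \<bullet> x)"
  using commutator_eigenspace[OF assms fusion_zero_zero[OF comp_zero_mem assms]]
    fusion_half_zero[OF comp_half_mem assms]
  by (simp add: eigenspace_half_iff)

lemma commutator_half:
  assumes "x \<in> Ah"
  shows "D x = (1/2) *s (form b x *s a - h \<bullet> x)"
  using commutator_eigenspace[OF assms fusion_zero_half[OF comp_zero_mem assms]]
  by (simp only: axis_mult_comp_half_mult[OF assms] scale_right_diff_distrib)

section \<open>The Leibniz rule on pairs containing the axis, where it always holds\<close>

lemma leibniz_axis_axis: "D (a \<bullet> a) = a \<bullet> D a + D a \<bullet> a"
proof -
  \<comment> \<open>\<open>D a\<close> is a multiple of \<open>h\<close> and so lies in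
    \<open>Ah\<close>; the two halves then add up to \<open>D a\<close>.\<close>
  have "a \<bullet> D a = (1/2) *s D a"
    using comp_half_mem[of b] subspace_eigenspace[of a "1/2"]
    by (metis commutator_axis eigenspace_half_iff subspace_neg subspace_scale)
  then show ?thesis
    by (simp only: axis_idem mult_commute[of "D a"] scale_half_add_half)
qed

text \<open>The left side is 0 because \<open>a \<bullet> x = 0\<close>. On the right,
  \<open>h \<bullet> x\<close> lies in \<open>Ah\<close>, so the two terms are plus and minus a
  quarter of it.\<close>

lemma leibniz_axis_zero:
  assumes "x \<in> A0"
  shows "D (a \<bullet> x) = a \<bullet> D x + D a \<bullet> x"
proof -
  have "a \<bullet> D x = (1/2) *s ((1/2) *s (h \<bullet> x))"
    using fusion_half_zero[OF comp_half_mem assms]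
    by (simp only: commutator_zero[OF assms] eigenspace_half_iff mult_scale_right)
  moreover have "D a \<bullet> x = - ((1/2) *s ((1/2) *s (h \<bullet> x)))"
    by (simp only: commutator_axis mult_bilinear)
  moreover have "D (a \<bullet> x) = 0"
    using assms by (simp add: eigenspace_zero_iff commutator_def mult_bilinear)
  ultimately show ?thesis by simp
qed

text \<open>Both sides equal half of \<open>D x\<close>: the first term on the right supplies the
  multiple of \<open>a\<close>, the second the multiple of \<open>h \<bullet> x\<close>.\<close>

lemma leibniz_axis_half:
  assumes "x \<in> Ah"
  shows "D (a \<bullet> x) = a \<bullet> D x + D a \<bullet> x"
proof -
  interpret D: Vector_Spaces.linear scale scale D by (rule linear_commutator_mult)
  have "a \<bullet> D x = (1/2) *s (form b x *s a - (1/2) *s (form b x *s a))"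
    by (simp only: commutator_half[OF assms] mult_bilinear axis_idem
        axis_mult_comp_half_mult[OF assms])
  also have "form b x *s a - (1/2) *s (form b x *s a) = (1/2) *s (form b x *s a)"
    using scale_half_add_half[of "form b x *s a"] by (metis add_diff_cancel_left')
  finally have "a \<bullet> D x + D a \<bullet> x =
      (1/2) *s ((1/2) *s (form b x *s a)) - (1/2) *s ((1/2) *s (h \<bullet> x))"
    by (simp only: commutator_axis mult_bilinear add_uminus_conv_diff)
  also have "\<dots> = (1/2) *s D x"
    by (simp only: commutator_half[OF assms] scale_right_diff_distrib)
  also have "\<dots> = D (a \<bullet> x)"
    using assms by (simp only: eigenspace_half_iff D.scale)
  finally show ?thesis by simp
qed

section \<open>The Leibniz rule on the remaining pairs of eigenvectors\<close>

lemma leibniz_zero_zero: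
  assumes "x \<in> A0" "y \<in> A0"
  shows "D (x \<bullet> y) = x \<bullet> D y + D x \<bullet> y \<longleftrightarrow> h \<bullet> (x \<bullet> y) = (h \<bullet> x) \<bullet> y + (h \<bullet> y) \<bullet> x"
proof -
  have "x \<bullet> D y + D x \<bullet> y = (1/2) *s ((h \<bullet> x) \<bullet> y + (h \<bullet> y) \<bullet> x)"
    by (simp only: commutator_zero assms mult_bilinear scale_right_distrib add.commute
        mult_commute[of x])
  then show ?thesis
    by (simp only: commutator_zero fusion_zero_zero assms scale_half_cancel)
qed

text \<open>The products \<open>h \<bullet> (x \<bullet> y)\<close> and
  \<open>(h \<bullet> y) \<bullet> x\<close> have the same coefficient at \<open>a\<close>, namely
  half of \<open>form b (x \<bullet> y)\<close>. These parts cancel in the Leibniz rule, which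
  leaves an identity involving only the zero components of the two products.\<close>

lemma leibniz_half_zero:
  assumes x: "x \<in> Ah" and y: "y \<in> A0"
  shows "D (x \<bullet> y) = x \<bullet> D y + D x \<bullet> y \<longleftrightarrow>
    comp_zero a (h \<bullet> (x \<bullet> y)) = (h \<bullet> x) \<bullet> y - comp_zero a ((h \<bullet> y) \<bullet> x)"
proof -
  let ?t = "form b (x \<bullet> y)"
  have xy: "x \<bullet> y \<in> Ah" and hy: "h \<bullet> y \<in> Ah"
    using fusion_half_zero comp_half_mem x y by blast+
  define p where "p = comp_zero a (h \<bullet> (x \<bullet> y))"
  define q where "q = comp_zero a ((h \<bullet> y) \<bullet> x)"
  have p: "h \<bullet> (x \<bullet> y) = (1/2) *s (?t *s a) + p"
    unfolding p_def scale_scale axis_form_comp_half_mult[OF xy, symmetric]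
    by (rule half_mult_half[OF comp_half_mem xy])
  have "form a ((h \<bullet> y) \<bullet> x) = 1/2 * form h (y \<bullet> x)"
    by (simp only: axis_form_half_mult[OF hy] form_assoc)
  then have f: "form a ((h \<bullet> y) \<bullet> x) = 1/2 * ?t"
    using form_comp_half[OF xy] by (simp only: mult_commute[of y])
  have q: "(h \<bullet> y) \<bullet> x = (1/2) *s (?t *s a) + q"
    unfolding q_def scale_scale f[symmetric] by (rule half_mult_half[OF hy x])
  have ay: "a \<bullet> y = 0"
    using y by (simp add: eigenspace_zero_iff)
  have "x \<bullet> D y + D x \<bullet> y = (1/2) *s ((h \<bullet> y) \<bullet> x - (h \<bullet> x) \<bullet> y)"
    by (simp add: commutator_zero[OF y] commutator_half[OF x] mult_bilinear ay
        scale_right_diff_distrib mult_commute[of x])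
  then have "D (x \<bullet> y) = x \<bullet> D y + D x \<bullet> y \<longleftrightarrow>
      ?t *s a - h \<bullet> (x \<bullet> y) = (h \<bullet> y) \<bullet> x - (h \<bullet> x) \<bullet> y"
    by (simp only: commutator_half[OF xy] scale_half_cancel)
  \<comment> \<open>The multiple of \<open>a\<close> is split in two: one half cancels against that
    of \<open>h \<bullet> (x \<bullet> y)\<close>, the other against that of
    \<open>(h \<bullet> y) \<bullet> x\<close>.\<close>
  also have "\<dots> \<longleftrightarrow> (1/2) *s (?t *s a) + (1/2) *s (?t *s a) - h \<bullet> (x \<bullet> y) =
      (h \<bullet> y) \<bullet> x - (h \<bullet> x) \<bullet> y"
    by (simp only: scale_half_add_half)
  also have "\<dots> \<longleftrightarrow> p = (h \<bullet> x) \<bullet> y - q"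
    unfolding p q by (auto simp: algebra_simps)
  finally show ?thesis
    by (simp only: p_def q_def)
qed

text \<open>The product \<open>x \<bullet> y\<close> has parts along \<open>a\<close> and in
  \<open>A0\<close>, on which \<open>D\<close> acts by different formulas. Rewriting the result
  through \<open>h \<bullet> (x \<bullet> y)\<close> produces the correction term
  \<open>form a (x \<bullet> y) *s h\<close>.\<close>

lemma leibniz_half_half:
  assumes x: "x \<in> Ah" and y: "y \<in> Ah"
  shows "D (x \<bullet> y) = x \<bullet> D y + D x \<bullet> y \<longleftrightarrow>
    h \<bullet> (x \<bullet> y) + (h \<bullet> x) \<bullet> y + (h \<bullet> y) \<bullet> x =
      (1/2 * form b y) *s x + (1/2 * form b x) *s y + form a (x \<bullet> y) *s h"
proof -
  define m where "m = form a (x \<bullet> y)"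
  define z where "z = comp_zero a (x \<bullet> y)"
  have z: "z \<in> A0"
    unfolding z_def by (rule comp_zero_mem)
  interpret D: Vector_Spaces.linear scale scale D by (rule linear_commutator_mult)
  have ha: "h \<bullet> a = (1/2) *s h"
    using comp_half_mem[of b] by (simp add: eigenspace_half_iff mult_commute)
  have xy: "x \<bullet> y = m *s a + z"
    unfolding m_def z_def by (rule half_mult_half[OF x y])
  then have hxy: "h \<bullet> (x \<bullet> y) = (1/2) *s (m *s h) + h \<bullet> z"
    by (simp only: mult_add_right mult_scale_right ha scale_left_commute)
  have "D (x \<bullet> y) = (1/2) *s (h \<bullet> z - (1/2) *s (m *s h))"
    by (simp add: xy D.add D.scale commutator_axis commutator_zero[OF z]
        scale_right_diff_distrib mult.commute)
  \<comment> \<open>By \<open>hxy\<close>, replacing \<open>h \<bullet> z\<close> by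
    \<open>h \<bullet> (x \<bullet> y)\<close> costs another half of \<open>m *s h\<close>.\<close>
  also have "h \<bullet> z - (1/2) *s (m *s h) = h \<bullet> (x \<bullet> y) - m *s h"
    using scale_half_add_half[of "m *s h"] by (simp add: hxy algebra_simps)
  finally have L: "D (x \<bullet> y) = (1/2) *s (h \<bullet> (x \<bullet> y) - m *s h)" .
  have "x \<bullet> D y + D x \<bullet> y =
      (1/2) *s (form b y *s (a \<bullet> x) - (h \<bullet> y) \<bullet> x + (form b x *s (a \<bullet> y) - (h \<bullet> x) \<bullet> y))"
    by (simp only: commutator_half x y mult_bilinear mult_commute[of x] scale_right_distrib)
  \<comment> \<open>The terms in \<open>x\<close> and \<open>y\<close> arise from the multiples of
    \<open>a\<close> in \<open>D y\<close> and \<open>D x\<close>.\<close>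
  also have "a \<bullet> x = (1/2) *s x"
    using x by (simp only: eigenspace_half_iff)
  also have "a \<bullet> y = (1/2) *s y"
    using y by (simp only: eigenspace_half_iff)
  finally have "D (x \<bullet> y) = x \<bullet> D y + D x \<bullet> y \<longleftrightarrow>
      h \<bullet> (x \<bullet> y) - m *s h =
      form b y *s ((1/2) *s x) - (h \<bullet> y) \<bullet> x + (form b x *s ((1/2) *s y) - (h \<bullet> x) \<bullet> y)"
    by (simp only: L scale_half_cancel)
  then show ?thesis
    unfolding m_def[symmetric] by (auto simp: algebra_simps)
qed

text \<open>The vector \<open>a\<close> with \<open>A0\<close> and \<open>Ah\<close> spans the
  algebra, and the rule is symmetric in its two arguments; hence three kinds of pairs remain after
  those containing \<open>a\<close>.\<close>

lemma derivation_commutator_iff: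
  "derivation D \<longleftrightarrow>
    (\<forall>x\<in>A0. \<forall>y\<in>A0. h \<bullet> (x \<bullet> y) = (h \<bullet> x) \<bullet> y + (h \<bullet> y) \<bullet> x) \<and>
    (\<forall>x\<in>Ah. \<forall>y\<in>A0.
       comp_zero a (h \<bullet> (x \<bullet> y)) = (h \<bullet> x) \<bullet> y - comp_zero a ((h \<bullet> y) \<bullet> x)) \<and>
    (\<forall>x\<in>Ah. \<forall>y\<in>Ah. h \<bullet> (x \<bullet> y) + (h \<bullet> x) \<bullet> y + (h \<bullet> y) \<bullet> x =
       (1/2 * form b y) *s x + (1/2 * form b x) *s y + form a (x \<bullet> y) *s h)"
proof -
  have sym: "D (x \<bullet> y) = x \<bullet> D y + D x \<bullet> y \<longleftrightarrow> D (y \<bullet> x) = y \<bullet> D x + D y \<bullet> x" for x y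
    by (metis mult_commute add.commute)
  have "derivation D \<longleftrightarrow>
      (\<forall>x\<in>A0. \<forall>y\<in>A0. D (x \<bullet> y) = x \<bullet> D y + D x \<bullet> y) \<and>
      (\<forall>x\<in>Ah. \<forall>y\<in>A0. D (x \<bullet> y) = x \<bullet> D y + D x \<bullet> y) \<and>
      (\<forall>x\<in>Ah. \<forall>y\<in>Ah. D (x \<bullet> y) = x \<bullet> D y + D x \<bullet> y)"
    unfolding derivation_iff_spanning[OF linear_commutator_mult span_eigenspaces]
    using leibniz_axis_axis leibniz_axis_zero leibniz_axis_half sym by blast
  then show ?thesis
    by (simp only: leibniz_zero_zero leibniz_half_zero leibniz_half_half cong: ball_cong)
qed

end

end

theorem theorem1p2:
  fixes scale :: "'f::field \<Rightarrow> 'a::ab_group_add \<Rightarrow> 'a"  (infixr "*s" 75)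
    and mult :: "'a \<Rightarrow> 'a \<Rightarrow> 'a"  (infixl "\<bullet>" 70)
    and form :: "'a \<Rightarrow> 'a \<Rightarrow> 'f"
    and a b :: 'a
  assumes "frobenius_algebra scale mult form"
    and "frobenius_algebra.is_axis scale mult form a"
    and "frobenius_algebra.is_axis scale mult form b"
  shows "frobenius_algebra.derivation scale mult (commutator (mult a) (mult b)) \<longleftrightarrow>
    (let A0 = frobenius_algebra.eigenspace scale mult a 0;
         Ah = frobenius_algebra.eigenspace scale mult a (1/2);
         p0 = frobenius_algebra.comp_zero scale mult form a;
         bh = frobenius_algebra.comp_half scale mult form a b
     in
       (\<forall>x\<in>A0. \<forall>y\<in>A0. bh \<bullet> (x \<bullet> y) = (bh \<bullet> x) \<bullet> y + (bh \<bullet> y) \<bullet> x) \<and>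
       (\<forall>x\<in>Ah. \<forall>y\<in>A0. p0 (bh \<bullet> (x \<bullet> y)) = (bh \<bullet> x) \<bullet> y - p0 ((bh \<bullet> y) \<bullet> x)) \<and>
       (\<forall>x\<in>Ah. \<forall>y\<in>Ah.
          bh \<bullet> (x \<bullet> y) + (bh \<bullet> x) \<bullet> y + (bh \<bullet> y) \<bullet> x
          = (1/2 * form b y) *s x + (1/2 * form b x) *s y + form a (x \<bullet> y) *s bh))"
proof -
  interpret frobenius_algebra scale mult form by fact
  interpret frobenius_algebra_axis scale mult form a
    by unfold_locales fact
  show ?thesis
    unfolding Let_def by (rule derivation_commutator_iff)
qed

end
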